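(* Let $x_1,\dots,x_n$ be distinct real numbers. Then $$\max_M\sum_{i\in M}x_i\ \ge\ \Bigl(\sum_{i=1}^n\max(x_i,0)^2\Bigr)^{1/2},$$ where the maximum is over all subsets $M\subseteq\{1,\dots,n\}$ of indices $i_1<\dots<i_k$ such that the sequence $x_{i_1},\dots,x_{i_k}$ is monotone (increasing or decreasing), with the convention that the empty sum is $0$ (the empty set $M$ being allowed). *)

theory Defs
  imports Complex_Main
begin

end

theory Submission
  imports Defs "HOL-Analysis.Analysis"
begin

text \<open>
  Only the positive terms matter, and they are turned into squares packed into a bigger square.
  Let \<open>S\<close> be the maximum on the left-hand side. To every index \<open>i\<close> with \<open>x i > 0\<close> attach the
  largest sum \<open>a i\<close> of an increasing subsequence of positive terms ending at \<open>i\<close>, the largest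
  sum \<open>d i\<close> of such a decreasing subsequence, and the square of side \<open>x i\<close> whose upper right
  corner is \<open>(a i, d i)\<close>. Since \<open>x i \<le> a i \<le> S\<close> and \<open>x i \<le> d i \<le> S\<close>, this square lies in the
  square from the origin to \<open>(S, S)\<close>. For \<open>i < j\<close>, either \<open>x i \<le> x j\<close>, and appending \<open>j\<close> to an
  increasing subsequence ending at \<open>i\<close> gives \<open>a i \<le> a j - x j\<close>, or \<open>x i \<ge> x j\<close>, and likewise
  \<open>d i \<le> d j - x j\<close>: the first square lies entirely to the left of, or entirely below, the second.
  So the interiors are disjoint, and comparing areas gives \<open>(\<Sum>i. (max (x i) 0)\<^sup>2) \<le> S\<^sup>2\<close>. This is
  the argument of Seidenberg for the Erdos-Szekeres theorem, with lengths of subsequences replaced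
  by sums, and the counting of points replaced by the comparison of areas.
\<close>

text \<open>
  Each square is given by its upper right corner \<open>(a i, d i)\<close> and its side \<open>s i\<close>. It is taken
  open, so that squares that touch are disjoint sets and their Lebesgue measures add up.
\<close>

lemma sum_squares_le_of_square_packing:
  fixes a d s :: "'i \<Rightarrow> real"
  assumes "finite I" and "S \<ge> 0"
    and nonneg: "\<And>i. i \<in> I \<Longrightarrow> 0 \<le> s i"
    and left: "\<And>i. i \<in> I \<Longrightarrow> s i \<le> a i" and right: "\<And>i. i \<in> I \<Longrightarrow> a i \<le> S"
    and lower: "\<And>i. i \<in> I \<Longrightarrow> s i \<le> d i" and upper: "\<And>i. i \<in> I \<Longrightarrow> d i \<le> S"
    and separated: "\<And>i j. i \<in> I \<Longrightarrow> j \<in> I \<Longrightarrow> i \<noteq> j \<Longrightarrow>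
      a i \<le> a j - s j \<or> a j \<le> a i - s i \<or> d i \<le> d j - s j \<or> d j \<le> d i - s i"
  shows "(\<Sum>i\<in>I. (s i)\<^sup>2) \<le> S\<^sup>2"
proof -
  define B where "B i = box (a i - s i, d i - s i) (a i, d i)" for i
  have area: "measure lborel (B i) = (s i)\<^sup>2" if "i \<in> I" for i
    using nonneg[OF that]
    by (simp add: B_def measure_lborel_box_eq Basis_prod_def sum.union_disjoint
        prod.union_disjoint prod.reindex inj_on_def power2_eq_square)
  have disj: "disjoint_family_on B I"
    unfolding disjoint_family_on_def B_def
    using separated by (fastforce simp: box_prod)
  have "(\<Sum>i\<in>I. (s i)\<^sup>2) = measure lborel (\<Union>i\<in>I. B i)"
    using disj \<open>finite I\<close> area
    by (subst measure_finite_Union) (auto simp: B_def emeasure_lborel_box_eq)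
  also have "\<dots> \<le> measure lborel (cbox (0, 0) (S, S))"
  proof (rule measure_mono_fmeasurable)
    show "(\<Union>i\<in>I. B i) \<subseteq> cbox (0, 0) (S, S)"
      using left right lower upper by (fastforce simp: B_def box_prod cbox_prod)
  qed (auto simp: B_def intro!: borel_open open_UN)
  also have "\<dots> = S\<^sup>2"
    using \<open>S \<ge> 0\<close> by (simp add: content_Pair power2_eq_square)
  finally show ?thesis .
qed

definition chains_ending_at ::
  "('b \<Rightarrow> 'b \<Rightarrow> bool) \<Rightarrow> ('a::linorder \<Rightarrow> 'b) \<Rightarrow> 'a set \<Rightarrow> 'a \<Rightarrow> 'a set set"
  where "chains_ending_at R f P i =
    {M. M \<subseteq> P \<inter> {..i} \<and> i \<in> M \<and> monotone_on M (\<le>) R f}"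

text \<open>
  The relation \<open>R\<close> is left open so that \<open>(\<le>)\<close> and \<open>(\<ge>)\<close> give the two coordinates of the corner of
  a square.
\<close>

definition max_chain_sum ::
  "(real \<Rightarrow> real \<Rightarrow> bool) \<Rightarrow> ('a::linorder \<Rightarrow> real) \<Rightarrow> 'a set \<Rightarrow> 'a \<Rightarrow> real"
  where "max_chain_sum R f P i = Max (sum f ` chains_ending_at R f P i)"

lemma finite_chains_ending_at: "finite P \<Longrightarrow> finite (chains_ending_at R f P i)"
  by (rule finite_subset[of _ "Pow P"]) (auto simp: chains_ending_at_def)

lemma singleton_in_chains_ending_at:
  "reflp R \<Longrightarrow> i \<in> P \<Longrightarrow> {i} \<in> chains_ending_at R f P i"
  by (auto simp: chains_ending_at_def monotone_on_def reflpD)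

lemma insert_in_chains_ending_at:
  assumes "reflp R" "transp R" "i < j" "j \<in> P" "R (f i) (f j)"
    and M: "M \<in> chains_ending_at R f P i"
  shows "insert j M \<in> chains_ending_at R f P j"
proof -
  have le: "k \<le> i" "k \<in> P" if "k \<in> M" for k
    using M that by (auto simp: chains_ending_at_def)
  have "i \<in> M" and mono: "monotone_on M (\<le>) R f"
    using M by (auto simp: chains_ending_at_def)
  have "R (f k) (f j)" if "k \<in> M" for k
    using monotone_onD[OF mono that \<open>i \<in> M\<close> le(1)[OF that]] assms(2,5) by (meson transpD)
  moreover have "\<not> j \<le> k" if "k \<in> M" for k
    using le(1)[OF that] \<open>i < j\<close> by simp
  ultimately show ?thesis
    using le assms(1,3,4) mono
    by (force simp: chains_ending_at_def monotone_on_def reflpD)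
qed

lemma max_chain_sum_attained:
  assumes "finite P" "reflp R" "i \<in> P"
  obtains M where "M \<in> chains_ending_at R f P i" "max_chain_sum R f P i = sum f M"
proof -
  have "Max (sum f ` chains_ending_at R f P i) \<in> sum f ` chains_ending_at R f P i"
    using assms singleton_in_chains_ending_at[of R i P f]
    by (intro Max_in) (auto simp: finite_chains_ending_at)
  then show ?thesis
    using that by (auto simp: max_chain_sum_def)
qed

lemma sum_le_max_chain_sum:
  "finite P \<Longrightarrow> M \<in> chains_ending_at R f P i \<Longrightarrow> sum f M \<le> max_chain_sum R f P i"
  unfolding max_chain_sum_def by (intro Max_ge) (auto simp: finite_chains_ending_at)

lemma max_chain_sum_ge_self:
  "finite P \<Longrightarrow> reflp R \<Longrightarrow> i \<in> P \<Longrightarrow> f i \<le> max_chain_sum R f P i"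
  using sum_le_max_chain_sum[OF _ singleton_in_chains_ending_at[of R i P f]] by simp

text \<open>
  Appending \<open>j\<close> to an optimal chain ending at \<open>i\<close>. The conclusion is written as the separation of
  two intervals, \<open>j\<close> having the interval of length \<open>f j\<close> with right endpoint
  \<open>max_chain_sum R f P j\<close>: it is the projection to one axis of the separation of two squares.
\<close>

lemma max_chain_sum_step:
  assumes "finite P" "reflp R" "transp R" "i \<in> P" "j \<in> P" "i < j" "R (f i) (f j)"
  shows "max_chain_sum R f P i \<le> max_chain_sum R f P j - f j"
proof -
  obtain M where M: "M \<in> chains_ending_at R f P i" and eq: "max_chain_sum R f P i = sum f M"
    by (rule max_chain_sum_attained[OF assms(1,2,4)])
  have "M \<subseteq> P" "j \<notin> M"
    using M \<open>i < j\<close> by (auto simp: chains_ending_at_def)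
  then have "sum f (insert j M) = f j + sum f M"
    using \<open>finite P\<close> finite_subset by (subst sum.insert) auto
  moreover have "sum f (insert j M) \<le> max_chain_sum R f P j"
    using assms M by (intro sum_le_max_chain_sum insert_in_chains_ending_at[where i = i])
  ultimately show ?thesis
    using eq by simp
qed

theorem corollary3p5:
  fixes x :: "nat \<Rightarrow> real" and n :: nat
  assumes "inj_on x {1..n}"
  shows "(MAX M \<in> {M. M \<subseteq> {1..n} \<and> (mono_on M x \<or> antimono_on M x)}. \<Sum>i\<in>M. x i)
           \<ge> sqrt (\<Sum>i=1..n. (max (x i) 0)\<^sup>2)"
proof -
  define F where "F = {M. M \<subseteq> {1..n} \<and> (mono_on M x \<or> antimono_on M x)}"
  define S where "S = (MAX M\<in>F. \<Sum>i\<in>M. x i)"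
  define P where "P = {i \<in> {1..n}. x i > 0}"
  let ?a = "max_chain_sum (\<le>) x P" and ?d = "max_chain_sum (\<ge>) x P"
  have "finite P" and "finite F"
    by (auto simp: P_def F_def)
  have S_ge: "sum x M \<le> S" if "M \<in> F" for M
    unfolding S_def using \<open>finite F\<close> that by (intro Max_ge) auto
  have "{} \<in> F"
    by (auto simp: F_def monotone_on_def)
  from S_ge[OF this] have "S \<ge> 0"
    by simp
  have chain_le: "max_chain_sum R x P i \<le> S"
    if i: "i \<in> P" and R: "R = (\<le>) \<or> R = (\<ge>)" for R i
  proof -
    have "reflp R"
      using R by auto
    obtain M where M: "M \<in> chains_ending_at R x P i" "max_chain_sum R x P i = sum x M"
      by (rule max_chain_sum_attained[OF \<open>finite P\<close> \<open>reflp R\<close> i])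
    have "P \<subseteq> {1..n}"
      by (auto simp: P_def)
    then have "M \<in> F"
      using M(1) R unfolding chains_ending_at_def F_def by blast
    then show ?thesis
      using S_ge M(2) by simp
  qed
  have "?a i \<le> ?a j - x j \<or> ?d i \<le> ?d j - x j" if "i \<in> P" "j \<in> P" "i < j" for i j
    using max_chain_sum_step[of P "(\<le>)" i j x] max_chain_sum_step[of P "(\<ge>)" i j x]
      \<open>finite P\<close> that by (cases "x i \<le> x j") auto
  then have "(\<Sum>i\<in>P. (x i)\<^sup>2) \<le> S\<^sup>2"
    using \<open>finite P\<close> \<open>S \<ge> 0\<close> chain_le max_chain_sum_ge_self[of P _ _ x]
    by (intro sum_squares_le_of_square_packing[where a = ?a and d = ?d])
       (auto simp: P_def neq_iff)
  moreover have "(\<Sum>i=1..n. (max (x i) 0)\<^sup>2) = (\<Sum>i\<in>P. (x i)\<^sup>2)"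
    by (rule sum.mono_neutral_cong_right) (auto simp: P_def max_def)
  ultimately have "sqrt (\<Sum>i=1..n. (max (x i) 0)\<^sup>2) \<le> S"
    using \<open>S \<ge> 0\<close> by (simp add: real_le_lsqrt)
  then show ?thesis
    by (simp add: S_def F_def)
qed

end
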